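(* Let $k \geq 2$ be an integer, let $s_1, \dots, s_{k-1}$ be positive integers, and let $t$ be an integer with $t \geq 2^{s_1 + \cdots + s_{k-1}}$. Let $H = K_{s_1, \dots, s_{k-1}, t}$ be the complete $k$-partite graph with parts of sizes $s_1, \dots, s_{k-1}, t$, and let $N = |E(H)|$ be its number of edges. Then for every integer $n \geq s_1 + \cdots + s_{k-1} + t + 2$ there exists an $H$-intersecting family of subgraphs of $K_n$ of size at least $$\frac{(t + 2)\left(2^{s_1 + \cdots + s_{k-1}} - 1\right) + 1}{2^{|E(K_{s_1, \dots, s_{k-1}, t+2})|}}\, 2^{\binom{n}{2}},$$ and moreover $$\frac{(t + 2)\left(2^{s_1 + \cdots + s_{k-1}} - 1\right) + 1}{2^{|E(K_{s_1, \dots, s_{k-1}, t+2})|}}\, 2^{\binom{n}{2}} > \frac{1}{2^N}\, 2^{\binom{n}{2}}.$$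
   Context: $K_n$ is the complete graph on $n$ labelled vertices; its subgraphs are labelled and identified with their edge sets (so there are $2^{\binom{n}{2}}$ of them). A family $\mathcal{F}$ of subgraphs of $K_n$ is $H$-intersecting if for any two graphs $F, F' \in \mathcal{F}$, the edge intersection $F \cap F'$ contains a subgraph isomorphic to $H$. $K_{a_1,\dots,a_k}$ denotes the complete $k$-partite graph with parts of sizes $a_1,\dots,a_k$, and $E(\cdot)$ denotes the edge set. *)

theory Defs
  imports Complex_Main
begin

text \<open>A simple undirected graph is a pair of a vertex set and a set of edges, an edge being a
  two-element set of vertices.\<close>

type_synonym 'a graph = "'a set \<times> 'a set set"

abbreviation verts :: "'a graph \<Rightarrow> 'a set" where
  "verts G \<equiv> fst G"

abbreviation edges :: "'a graph \<Rightarrow> 'a set set" where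
  "edges G \<equiv> snd G"

definition simple_graph :: "'a graph \<Rightarrow> bool" where
  "simple_graph G \<longleftrightarrow> (\<forall>e\<in>edges G. e \<subseteq> verts G \<and> card e = 2)"

definition is_subgraph :: "'a graph \<Rightarrow> 'a graph \<Rightarrow> bool" where
  "is_subgraph G' G \<longleftrightarrow> simple_graph G' \<and> verts G' \<subseteq> verts G \<and> edges G' \<subseteq> edges G"

definition graph_iso :: "'a graph \<Rightarrow> 'b graph \<Rightarrow> bool" where
  "graph_iso G G' \<longleftrightarrow>
     (\<exists>f. bij_betw f (verts G) (verts G') \<and>
          (\<forall>u\<in>verts G. \<forall>v\<in>verts G. {u, v} \<in> edges G \<longleftrightarrow> {f u, f v} \<in> edges G'))"

definition complete_graph :: "nat \<Rightarrow> nat graph" where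
  "complete_graph n = ({1..n}, {e. e \<subseteq> {1..n} \<and> card e = 2})"

text \<open>The list holds the part sizes; vertex \<open>(i, a)\<close> is the \<open>a\<close>-th element of part \<open>i\<close>.\<close>

definition complete_multipartite :: "nat list \<Rightarrow> (nat \<times> nat) graph" where
  "complete_multipartite as =
     (let V = (SIGMA i:{..<length as}. {..<as ! i})
      in (V, {{u, v} | u v. u \<in> V \<and> v \<in> V \<and> fst u \<noteq> fst v}))"

text \<open>Subgraphs of \<open>K\<^sub>n\<close> are identified with their edge sets, so a family of subgraphs is a set
  of edge sets, and the intersection of two members is read as a graph on all of \<open>{1..n}\<close>.
  The two members are not required to be distinct.\<close>

definition intersecting_family :: "'a graph \<Rightarrow> nat \<Rightarrow> nat set set set \<Rightarrow> bool" where
  "intersecting_family H n \<F> \<longleftrightarrow>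
     \<F> \<subseteq> Pow (edges (complete_graph n)) \<and>
     (\<forall>F\<in>\<F>. \<forall>F'\<in>\<F>. \<exists>H'. is_subgraph H' (verts (complete_graph n), F \<inter> F') \<and> graph_iso H H')"

end

theory Submission
  imports Defs
begin

text \<open>
  Write \<open>m\<close> for the sum of the sizes \<open>s\<close>. Adding one vertex to the last part of a complete
  multipartite graph adds a star of \<open>m\<close> edges, joining the new vertex to all vertices of the other
  parts, and the stars of distinct vertices of the last part are disjoint. Fix a copy \<open>G\<close> of
  \<open>K\<^bsub>s,t+2\<^esub>\<close> inside \<open>K\<^sub>n\<close>, and let the family consist of all edge sets \<open>F\<close> such that the edges of
  \<open>G\<close> missing from \<open>F\<close> all lie in a single star.

  Two members of the family together spoil at most two of the \<open>t + 2\<close> vertices of the last part;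
  the remaining \<open>t\<close> of them, with the other parts, span a copy of \<open>K\<^bsub>s,t\<^esub>\<close> in the intersection
  (\<open>snoc_embed_avoiding\<close>, \<open>intersecting_of_image_edges\<close>).

  For the size, the set of missing edges is either empty or a nonempty subset of exactly one of the
  \<open>t + 2\<close> disjoint stars, which gives \<open>(t + 2) (2^m - 1) + 1\<close> possibilities, and the edges outside
  \<open>G\<close> are free (\<open>card_superset_up_to_block\<close>).

  Finally \<open>K\<^bsub>s,t+2\<^esub>\<close> has \<open>2 m\<close> more edges than \<open>K\<^bsub>s,t\<^esub>\<close>, so the strict inequality
  says \<open>(t + 2) (2^m - 1) + 1 > 4^m\<close>. For \<open>t = 2^m\<close> the left side is \<open>4^m + 2^m - 1\<close>, and it
  increases with \<open>t\<close>; since \<open>s\<close> is a nonempty list of positive numbers, \<open>m \<ge> 1\<close> and \<open>2^m - 1 > 0\<close>.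
\<close>

section \<open>Sets containing a given set up to one block\<close>

text \<open>The empty set is a subset of every block, a nonempty one of at most one.\<close>

lemma card_subsets_of_some_block:
  assumes "finite V" "V \<noteq> {}"
    and fin: "\<And>v. v \<in> V \<Longrightarrow> finite (S v)"
    and card: "\<And>v. v \<in> V \<Longrightarrow> card (S v) = m"
    and disj: "\<And>v w. v \<in> V \<Longrightarrow> w \<in> V \<Longrightarrow> v \<noteq> w \<Longrightarrow> S v \<inter> S w = {}"
  shows "card {X. \<exists>v\<in>V. X \<subseteq> S v} = card V * (2 ^ m - 1) + 1"
proof -
  have eq: "{X. \<exists>v\<in>V. X \<subseteq> S v} = insert {} (\<Union>v\<in>V. Pow (S v) - {{}})"
    using \<open>V \<noteq> {}\<close> by auto
  have "card (\<Union>v\<in>V. Pow (S v) - {{}}) = (\<Sum>v\<in>V. card (Pow (S v) - {{}}))"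
  proof (rule card_UN_disjoint)
    show "\<forall>v\<in>V. \<forall>w\<in>V. v \<noteq> w \<longrightarrow> (Pow (S v) - {{}}) \<inter> (Pow (S w) - {{}}) = {}"
      using disj by blast
  qed (use assms in auto)
  also have "\<dots> = card V * (2 ^ m - 1)"
    using fin card by (simp add: card_Pow card_Diff_singleton)
  finally have "card (\<Union>v\<in>V. Pow (S v) - {{}}) = card V * (2 ^ m - 1)" .
  moreover have "finite (\<Union>v\<in>V. Pow (S v) - {{}})"
    using \<open>finite V\<close> fin by blast
  moreover have "{} \<notin> (\<Union>v\<in>V. Pow (S v) - {{}})" by blast
  ultimately show ?thesis
    unfolding eq by (metis Suc_eq_plus1 card_insert_disjoint)
qed

text \<open>A subset of \<open>E\<close> amounts to the part of \<open>G\<close> that it misses and the part of \<open>E - G\<close> that it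
  contains; only the former is restricted.\<close>

lemma card_superset_up_to_block:
  assumes "finite E" "G \<subseteq> E" "finite V" "V \<noteq> {}"
    and sub: "\<And>v. v \<in> V \<Longrightarrow> S v \<subseteq> G"
    and card: "\<And>v. v \<in> V \<Longrightarrow> card (S v) = m"
    and disj: "\<And>v w. v \<in> V \<Longrightarrow> w \<in> V \<Longrightarrow> v \<noteq> w \<Longrightarrow> S v \<inter> S w = {}"
  shows "card {F. F \<subseteq> E \<and> (\<exists>v\<in>V. G - S v \<subseteq> F)}
    = (card V * (2 ^ m - 1) + 1) * 2 ^ (card E - card G)"
proof -
  have "bij_betw (\<lambda>F. (G - F, F - G)) {F. F \<subseteq> E \<and> (\<exists>v\<in>V. G - S v \<subseteq> F)}
      ({X. \<exists>v\<in>V. X \<subseteq> S v} \<times> Pow (E - G))"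
  proof (rule bij_betw_byWitness[where f' = "\<lambda>(X, Y). (G - X) \<union> Y"])
    show "\<forall>p\<in>{X. \<exists>v\<in>V. X \<subseteq> S v} \<times> Pow (E - G).
        (\<lambda>F. (G - F, F - G)) ((\<lambda>(X, Y). (G - X) \<union> Y) p) = p"
      using sub by fastforce
    show "(\<lambda>(X, Y). (G - X) \<union> Y) ` ({X. \<exists>v\<in>V. X \<subseteq> S v} \<times> Pow (E - G))
        \<subseteq> {F. F \<subseteq> E \<and> (\<exists>v\<in>V. G - S v \<subseteq> F)}"
      using \<open>G \<subseteq> E\<close> by fastforce
  qed auto
  then have "card {F. F \<subseteq> E \<and> (\<exists>v\<in>V. G - S v \<subseteq> F)}
      = card {X. \<exists>v\<in>V. X \<subseteq> S v} * card (Pow (E - G))"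
    by (simp add: bij_betw_same_card card_cartesian_product)
  moreover have "card {X. \<exists>v\<in>V. X \<subseteq> S v} = card V * (2 ^ m - 1) + 1"
  proof (rule card_subsets_of_some_block[OF assms(3,4) _ card disj])
    show "finite (S v)" if "v \<in> V" for v
      using sub[OF that] assms(1,2) by (meson finite_subset)
  qed
  moreover have "card (Pow (E - G)) = 2 ^ (card E - card G)"
    using assms by (simp add: card_Pow card_Diff_subset finite_subset)
  ultimately show ?thesis by simp
qed

section \<open>Complete multipartite graphs and their last part\<close>

lemma verts_complete_multipartite:
  "verts (complete_multipartite as) = (SIGMA i:{..<length as}. {..<as ! i})"
  by (simp add: complete_multipartite_def Let_def)

lemma edges_complete_multipartite:
  "edges (complete_multipartite as) = {{u, v} | u v. u \<in> verts (complete_multipartite as)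
     \<and> v \<in> verts (complete_multipartite as) \<and> fst u \<noteq> fst v}"
  by (simp add: complete_multipartite_def Let_def)

lemma finite_verts_complete_multipartite: "finite (verts (complete_multipartite as))"
  by (simp add: verts_complete_multipartite)

lemma edge_subset_verts:
  "e \<in> edges (complete_multipartite as) \<Longrightarrow> e \<subseteq> verts (complete_multipartite as)"
  by (auto simp: edges_complete_multipartite)

lemma finite_edges_complete_multipartite: "finite (edges (complete_multipartite as))"
  by (rule finite_subset[of _ "Pow (verts (complete_multipartite as))"])
    (auto simp: finite_verts_complete_multipartite dest: edge_subset_verts)

lemma card_edge_complete_multipartite:
  "e \<in> edges (complete_multipartite as) \<Longrightarrow> card e = 2"
  by (auto simp: edges_complete_multipartite card_2_iff)

lemma card_verts_complete_multipartite: "card (verts (complete_multipartite as)) = sum_list as"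
  by (simp add: verts_complete_multipartite sum_list_sum_nth atLeast0LessThan)

lemma verts_snoc:
  "verts (complete_multipartite (s @ [r]))
   = verts (complete_multipartite s) \<union> {length s} \<times> {..<r}"
  by (auto simp: verts_complete_multipartite nth_append less_Suc_eq split: if_splits)

text \<open>The edges gained when vertex \<open>(length s, v)\<close> is added to a new last part.\<close>

definition last_star :: "nat list \<Rightarrow> nat \<Rightarrow> (nat \<times> nat) set set" where
  "last_star s v = (\<lambda>u. {u, (length s, v)}) ` verts (complete_multipartite s)"

lemma fst_less_length: "u \<in> verts (complete_multipartite s) \<Longrightarrow> fst u < length s"
  by (auto simp: verts_complete_multipartite)

lemma last_notin_verts: "(length s, v) \<notin> verts (complete_multipartite s)"
  using fst_less_length by fastforce

lemma finite_last_star: "finite (last_star s v)"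
  by (simp add: last_star_def finite_verts_complete_multipartite)

lemma card_last_star: "card (last_star s v) = sum_list s"
proof -
  have "inj_on (\<lambda>u. {u, (length s, v)}) (verts (complete_multipartite s))"
    by (auto simp: inj_on_def doubleton_eq_iff)
  then show ?thesis
    by (simp add: last_star_def card_image card_verts_complete_multipartite)
qed

lemma last_star_disjoint: "v \<noteq> w \<Longrightarrow> last_star s v \<inter> last_star s w = {}"
  by (auto simp: last_star_def doubleton_eq_iff last_notin_verts)

lemma edges_snoc:
  "edges (complete_multipartite (s @ [r]))
   = edges (complete_multipartite s) \<union> (\<Union>v<r. last_star s v)" (is "?L = ?C \<union> ?R")
proof
  show "?L \<subseteq> ?C \<union> ?R"
  proof
    fix e assume "e \<in> ?L"
    then obtain u v where e: "e = {u, v}" and ne: "fst u \<noteq> fst v"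
      and uv: "u \<in> verts (complete_multipartite (s @ [r]))"
        "v \<in> verts (complete_multipartite (s @ [r]))"
      by (auto simp: edges_complete_multipartite[of "s @ [r]"])
    consider "u \<in> verts (complete_multipartite s)" "v \<in> verts (complete_multipartite s)"
      | "u \<in> verts (complete_multipartite s)" "v \<in> {length s} \<times> {..<r}"
      | "v \<in> verts (complete_multipartite s)" "u \<in> {length s} \<times> {..<r}"
      using uv ne by (auto simp: verts_snoc)
    then show "e \<in> ?C \<union> ?R"
    proof cases
      case 1
      then have "e \<in> ?C" unfolding edges_complete_multipartite using e ne by blast
      then show ?thesis ..
    next
      case 2
      then show ?thesis using e by (auto simp: last_star_def)
    next
      case 3
      then show ?thesis using e by (auto simp: last_star_def insert_commute)
    qed
  qed
  show "?C \<union> ?R \<subseteq> ?L"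
  proof
    fix e assume "e \<in> ?C \<union> ?R"
    then show "e \<in> ?L"
    proof
      assume "e \<in> ?C"
      then show ?thesis by (auto simp: edges_complete_multipartite verts_snoc)
    next
      assume "e \<in> ?R"
      then obtain u v where "v < r" "u \<in> verts (complete_multipartite s)"
        "e = {u, (length s, v)}"
        by (auto simp: last_star_def)
      moreover from this have "fst u \<noteq> fst (length s, v)"
        using fst_less_length[of u s] by simp
      ultimately show ?thesis
        unfolding edges_complete_multipartite[of "s @ [r]"] verts_snoc by blast
    qed
  qed
qed

lemma card_edges_snoc:
  "card (edges (complete_multipartite (s @ [r])))
   = card (edges (complete_multipartite s)) + r * sum_list s"
proof -
  have "edges (complete_multipartite s) \<inter> (\<Union>v<r. last_star s v) = {}"
    using last_notin_verts by (fastforce simp: last_star_def dest: edge_subset_verts)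
  moreover have "card (\<Union>v<r. last_star s v) = (\<Sum>v<r. card (last_star s v))"
    by (rule card_UN_disjoint) (auto simp: finite_last_star dest: last_star_disjoint)
  ultimately show ?thesis
    by (simp add: edges_snoc card_Un_disjoint finite_edges_complete_multipartite
        finite_last_star card_last_star)
qed

text \<open>Two deleted vertices of a last part of size \<open>t + 2\<close> leave room for a part of size \<open>t\<close>:
  keep the first parts fixed and renumber the last one.\<close>

lemma snoc_embed_avoiding:
  obtains h where "inj_on h (verts (complete_multipartite (s @ [t])))"
    and "h ` verts (complete_multipartite (s @ [t]))
      \<subseteq> verts (complete_multipartite (s @ [t + 2]))"
    and "\<And>e. e \<in> edges (complete_multipartite (s @ [t])) \<Longrightarrow>
      h ` e \<in> edges (complete_multipartite (s @ [t + 2])) - (last_star s a \<union> last_star s b)"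
proof -
  have "card ({..<t + 2} - {a, b}) \<ge> card {..<t}"
    using diff_card_le_card_Diff[of "{a, b}" "{..<t + 2}"] card_insert_le_m1[of 2 "{b}" a]
    by simp
  then obtain g where g: "g ` {..<t} \<subseteq> {..<t + 2} - {a, b}" "inj_on g {..<t}"
    using card_le_inj[of "{..<t}" "{..<t + 2} - {a, b}"] by auto
  define h where "h = (\<lambda>u. if fst u = length s then (length s, g (snd u)) else u)"
  have h_low: "h u = u" if "u \<in> verts (complete_multipartite s)" for u
    using fst_less_length[OF that] by (simp add: h_def)
  have h_last: "h (length s, v) = (length s, g v)" for v
    by (simp add: h_def)
  have inj: "inj_on h (verts (complete_multipartite (s @ [t])))"
    using g(2) unfolding verts_snoc
    by (auto simp: inj_on_def h_low h_last last_notin_verts dest: fst_less_length)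
  have img: "h ` verts (complete_multipartite (s @ [t]))
      \<subseteq> verts (complete_multipartite (s @ [t + 2]))"
    using g(1) unfolding verts_snoc by (auto simp: h_low h_last)
  have "h ` e \<in> edges (complete_multipartite (s @ [t + 2])) - (last_star s a \<union> last_star s b)"
    if "e \<in> edges (complete_multipartite (s @ [t]))" for e
  proof -
    have "e \<in> edges (complete_multipartite s) \<or> (\<exists>v<t. e \<in> last_star s v)"
      using that by (auto simp: edges_snoc)
    then show ?thesis
    proof (elim disjE exE conjE)
      assume e: "e \<in> edges (complete_multipartite s)"
      then have "\<forall>u\<in>e. h u = u"
        using edge_subset_verts[OF e] h_low by blast
      then have "h ` e = e" by simp
      moreover have "e \<notin> last_star s a \<union> last_star s b"
        using edge_subset_verts[OF e] last_notin_verts by (auto simp: last_star_def)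
      ultimately show ?thesis using e by (auto simp: edges_snoc)
    next
      fix v assume v: "v < t" "e \<in> last_star s v"
      then have "h ` e \<in> last_star s (g v)"
        by (auto simp: last_star_def h_low h_last)
      moreover have "g v < t + 2" "g v \<noteq> a" "g v \<noteq> b"
        using v g(1) by auto
      ultimately show ?thesis
        using last_star_disjoint[of "g v" a s] last_star_disjoint[of "g v" b s]
        unfolding edges_snoc by blast
    qed
  qed
  with inj img show thesis by (rule that)
qed

section \<open>Copies of a graph inside an intersection\<close>

lemma graph_iso_image:
  assumes "inj_on f (verts G)" "\<And>e. e \<in> edges G \<Longrightarrow> e \<subseteq> verts G"
  shows "graph_iso G (f ` verts G, (`) f ` edges G)"
proof -
  have "{u, v} \<in> edges G \<longleftrightarrow> {f u, f v} \<in> (`) f ` edges G"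
    if "u \<in> verts G" "v \<in> verts G" for u v
  proof
    assume "{f u, f v} \<in> (`) f ` edges G"
    then obtain e where e: "e \<in> edges G" "f ` {u, v} = f ` e" by auto
    then have "{u, v} = e"
      using inj_on_image_eq_iff[OF assms(1), of "{u, v}" e] assms(2) that by auto
    then show "{u, v} \<in> edges G" using e by simp
  next
    assume "{u, v} \<in> edges G"
    then have "f ` {u, v} \<in> (`) f ` edges G" by (rule imageI)
    then show "{f u, f v} \<in> (`) f ` edges G" by simp
  qed
  then show ?thesis
    unfolding graph_iso_def using assms(1) by (auto simp: bij_betw_def intro!: exI[of _ f])
qed

text \<open>An injective placement of \<open>H\<close> whose edges land in the intersection already yields the required
  copy, because the image of \<open>H\<close> serves as the subgraph even when the intersection has further edges
  between the same vertices.\<close>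

lemma intersecting_of_image_edges:
  assumes "\<F> \<subseteq> Pow (edges (complete_graph n))"
    and sub: "\<And>e. e \<in> edges H \<Longrightarrow> e \<subseteq> verts H"
    and emb: "\<And>F F'. F \<in> \<F> \<Longrightarrow> F' \<in> \<F> \<Longrightarrow>
      \<exists>f. inj_on f (verts H) \<and> f ` verts H \<subseteq> {1..n} \<and> (`) f ` edges H \<subseteq> F \<inter> F'"
  shows "intersecting_family H n \<F>"
  unfolding intersecting_family_def
proof (intro conjI ballI)
  fix F F' assume FF': "F \<in> \<F>" "F' \<in> \<F>"
  then obtain f where f: "inj_on f (verts H)" "f ` verts H \<subseteq> {1..n}"
      "(`) f ` edges H \<subseteq> F \<inter> F'"
    using emb by blast
  have "card e = 2" if "e \<in> (`) f ` edges H" for e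
    using that f(3) FF'(1) assms(1) by (auto simp: complete_graph_def)
  moreover have "e \<subseteq> f ` verts H" if "e \<in> (`) f ` edges H" for e
    using that sub by blast
  ultimately have "is_subgraph (f ` verts H, (`) f ` edges H) (verts (complete_graph n), F \<inter> F')"
    using f(2,3) by (simp add: is_subgraph_def simple_graph_def complete_graph_def)
  moreover have "graph_iso H (f ` verts H, (`) f ` edges H)"
    using f(1) sub by (rule graph_iso_image)
  ultimately show "\<exists>H'. is_subgraph H' (verts (complete_graph n), F \<inter> F') \<and> graph_iso H H'"
    by blast
qed (rule assms(1))

section \<open>The intersecting family\<close>

text \<open>The bound on \<open>n\<close> is what allows \<open>K\<^bsub>s,t+2\<^esub>\<close> to be placed in \<open>K\<^sub>n\<close>. All combinatorics happens in
  the abstract graph; the placement \<open>\<phi>\<close> is injective on vertices, hence on edges, and so carries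
  the star structure over unchanged.\<close>

lemma exists_large_intersecting_family:
  assumes n: "n \<ge> sum_list s + t + 2"
  shows "\<exists>\<F>. intersecting_family (complete_multipartite (s @ [t])) n \<F> \<and>
    card \<F> = ((t + 2) * (2 ^ sum_list s - 1) + 1)
      * 2 ^ ((n choose 2) - card (edges (complete_multipartite (s @ [t + 2])))) \<and>
    card (edges (complete_multipartite (s @ [t + 2]))) \<le> n choose 2"
proof -
  let ?K = "complete_multipartite (s @ [t + 2])"
  let ?H = "complete_multipartite (s @ [t])"
  have "card (verts ?K) \<le> card {1..n}"
    using n by (simp only: card_verts_complete_multipartite) simp
  then obtain \<phi> where \<phi>: "\<phi> ` verts ?K \<subseteq> {1..n}" "inj_on \<phi> (verts ?K)"
    using card_le_inj[of "verts ?K" "{1..n}"] finite_verts_complete_multipartite by auto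
  define E where "E = edges (complete_graph n)"
  define G where "G = (`) \<phi> ` edges ?K"
  define S where "S = (\<lambda>v. (`) \<phi> ` last_star s v)"
  define \<F> where "\<F> = {F. F \<subseteq> E \<and> (\<exists>v\<in>{..<t + 2}. G - S v \<subseteq> F)}"
  have inj_edges: "inj_on ((`) \<phi>) (edges ?K)"
    by (rule inj_on_subset[OF inj_on_image_Pow[OF \<phi>(2)]]) (auto dest: edge_subset_verts)
  have star_sub: "last_star s v \<subseteq> edges ?K" if "v < t + 2" for v
    using that unfolding edges_snoc by blast
  have finE: "finite E" and cardE: "card E = n choose 2"
    using n_subsets[of "{1..n}" 2] by (auto simp: E_def complete_graph_def)
  have GE: "G \<subseteq> E"
  proof
    fix x assume "x \<in> G"
    then obtain e where e: "e \<in> edges ?K" "x = \<phi> ` e" by (auto simp: G_def)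
    have sub: "e \<subseteq> verts ?K" using e(1) by (rule edge_subset_verts)
    have "card x = card e"
      unfolding e(2) by (rule card_image) (rule inj_on_subset[OF \<phi>(2) sub])
    then show "x \<in> E"
      using card_edge_complete_multipartite[OF e(1)] sub \<phi>(1) e(2)
      by (auto simp: E_def complete_graph_def)
  qed
  have cardG: "card G = card (edges ?K)"
    unfolding G_def using inj_edges by (rule card_image)
  have S_sub: "S v \<subseteq> G" if "v < t + 2" for v
    using star_sub[OF that] by (auto simp: S_def G_def)
  have S_card: "card (S v) = sum_list s" if "v < t + 2" for v
    using card_image[OF inj_on_subset[OF inj_edges star_sub[OF that]]]
    by (simp add: S_def card_last_star)
  have S_disj: "S v \<inter> S w = {}" if "v < t + 2" "w < t + 2" "v \<noteq> w" for v w
    using inj_on_image_Int[OF inj_edges star_sub[OF that(1)] star_sub[OF that(2)]]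
      last_star_disjoint[OF that(3)] by (simp add: S_def)
  have "card \<F> = (card {..<t + 2} * (2 ^ sum_list s - 1) + 1) * 2 ^ (card E - card G)"
    unfolding \<F>_def
    by (rule card_superset_up_to_block) (use finE GE S_sub S_card S_disj in auto)
  then have "card \<F> = ((t + 2) * (2 ^ sum_list s - 1) + 1)
      * 2 ^ ((n choose 2) - card (edges ?K))"
    by (simp only: cardE cardG card_lessThan)
  moreover have "card (edges ?K) \<le> n choose 2"
    using card_mono[OF finE GE] by (simp add: cardE cardG)
  moreover have "intersecting_family ?H n \<F>"
  proof (rule intersecting_of_image_edges)
    show "\<F> \<subseteq> Pow (edges (complete_graph n))" by (auto simp: \<F>_def E_def)
    show "e \<subseteq> verts ?H" if "e \<in> edges ?H" for e using that by (rule edge_subset_verts)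
    fix F F' assume "F \<in> \<F>" "F' \<in> \<F>"
    then obtain a b where ab: "a < t + 2" "b < t + 2" "G - S a \<subseteq> F" "G - S b \<subseteq> F'"
      by (auto simp: \<F>_def)
    obtain h where h: "inj_on h (verts ?H)" "h ` verts ?H \<subseteq> verts ?K"
      and he: "\<And>e. e \<in> edges ?H \<Longrightarrow> h ` e \<in> edges ?K - (last_star s a \<union> last_star s b)"
      using snoc_embed_avoiding[of s t a b] by metis
    have "inj_on (\<phi> \<circ> h) (verts ?H)"
      using h \<phi>(2) by (auto intro: comp_inj_on inj_on_subset)
    moreover have "(\<phi> \<circ> h) ` verts ?H \<subseteq> {1..n}"
      using h(2) \<phi>(1) by auto
    moreover have "(\<phi> \<circ> h) ` e \<in> F \<inter> F'" if "e \<in> edges ?H" for e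
    proof -
      have K: "h ` e \<in> edges ?K" using he[OF that] by blast
      have not_S: "\<phi> ` h ` e \<notin> S v" if "v < t + 2" "h ` e \<notin> last_star s v" for v
        using inj_on_image_mem_iff[OF inj_edges K star_sub[OF that(1)]] that(2)
        by (simp add: S_def)
      have "\<phi> ` h ` e \<in> G" using K by (auto simp: G_def)
      moreover have "\<phi> ` h ` e \<notin> S a" "\<phi> ` h ` e \<notin> S b"
        using not_S ab(1,2) he[OF that] by auto
      ultimately show ?thesis using ab(3,4) by (auto simp: image_comp)
    qed
    ultimately show "\<exists>f. inj_on f (verts ?H) \<and> f ` verts ?H \<subseteq> {1..n}
        \<and> (`) f ` edges ?H \<subseteq> F \<inter> F'"
      by (intro exI[of _ "\<phi> \<circ> h"]) blast
  qed
  ultimately show ?thesis by blast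
qed

section \<open>Comparison with the family of all supergraphs of one copy\<close>

theorem theorem2p1:
  fixes k t n N :: nat and s :: "nat list" and H :: "(nat \<times> nat) graph"
  assumes "k \<ge> 2"
    and "length s = k - 1"
    and "\<forall>i<k - 1. s ! i > 0"
    and "t \<ge> 2 ^ sum_list s"
    and "H = complete_multipartite (s @ [t])"
    and "N = card (edges H)"
    and "n \<ge> sum_list s + t + 2"
  shows "(\<exists>\<F>. intersecting_family H n \<F> \<and>
            real (card \<F>) \<ge>
              ((real t + 2) * (2 ^ sum_list s - 1) + 1)
                / 2 ^ card (edges (complete_multipartite (s @ [t + 2]))) * 2 ^ (n choose 2))
       \<and> ((real t + 2) * (2 ^ sum_list s - 1) + 1)
              / 2 ^ card (edges (complete_multipartite (s @ [t + 2]))) * 2 ^ (n choose 2)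
          > 1 / 2 ^ N * 2 ^ (n choose 2)"
proof
  let ?m = "sum_list s" and ?M = "card (edges (complete_multipartite (s @ [t + 2])))"
  obtain \<F> where fam: "intersecting_family H n \<F>"
    and card: "card \<F> = ((t + 2) * (2 ^ ?m - 1) + 1) * 2 ^ ((n choose 2) - ?M)"
    and le: "?M \<le> n choose 2"
    using exists_large_intersecting_family[OF assms(7)] assms(5) by blast
  have "real (card \<F>) = ((real t + 2) * (2 ^ ?m - 1) + 1) * 2 ^ ((n choose 2) - ?M)"
    unfolding card by (simp only: of_nat_mult of_nat_add of_nat_diff[OF one_le_power[of 2]]
        of_nat_power of_nat_numeral of_nat_1)
  also have "\<dots> = ((real t + 2) * (2 ^ ?m - 1) + 1) / 2 ^ ?M * 2 ^ (n choose 2)"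
    using le by (simp add: power_diff)
  finally show "\<exists>\<F>. intersecting_family H n \<F> \<and> real (card \<F>) \<ge>
      ((real t + 2) * (2 ^ ?m - 1) + 1) / 2 ^ ?M * 2 ^ (n choose 2)"
    using fam by (intro exI[of _ \<F>]) simp
  have "s ! 0 \<in> set s" "s ! 0 > 0"
    using assms(1-3) by auto
  then have "?m > 0"
    using member_le_sum_list[of "s ! 0" s] by simp
  then have q: "(2::real) ^ ?m > 1" by simp
  have M: "?M = N + 2 * ?m"
    using card_edges_snoc[of s "t + 2"] card_edges_snoc[of s t] assms(5,6)
    by (simp add: algebra_simps)
  have "(2::real) ^ ?m \<le> real t"
    using assms(4) by (metis of_nat_le_iff of_nat_numeral of_nat_power)
  then have "(2 ^ ?m + 2) * (2 ^ ?m - 1) \<le> (real t + 2) * (2 ^ ?m - 1)"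
    using q by (intro mult_right_mono) auto
  moreover have "((2::real) ^ ?m + 2) * (2 ^ ?m - 1) + 1 = 2 ^ (2 * ?m) + (2 ^ ?m - 1)"
    unfolding power_even_eq power2_eq_square by algebra
  ultimately have "(real t + 2) * (2 ^ ?m - 1) + 1 > 2 ^ (2 * ?m)"
    using q by linarith
  then have "1 / 2 ^ N < ((real t + 2) * (2 ^ ?m - 1) + 1) / 2 ^ ?M"
    unfolding M power_add by (simp add: field_simps)
  then show "1 / 2 ^ N * 2 ^ (n choose 2)
      < ((real t + 2) * (2 ^ ?m - 1) + 1) / 2 ^ ?M * 2 ^ (n choose 2)"
    by (intro mult_strict_right_mono) auto
qed

end
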